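(* Let $x_1,x_2,\dots$ be independent identically distributed random variables in $[0,1]$ with common probability density $f$ such that $f(x)/(c x^{\beta})\to1$ as $x\to0^+$, where $c>0$ and $\beta>0$. Let $H_n$ be the harmonic mean of $x_1,\dots,x_n$ and let $\mathcal E=\mathbf E(1/x_1)$. Then $$\lim_{n\to\infty}\mathbf E(\mathcal E\,H_n)=1.$$
   Context: The harmonic mean is $H_n=1/X_n$ with $X_n=\frac1n\sum_{i=1}^n\frac1{x_i}$. *)

theory Defs
  imports "HOL-Probability.Probability"
begin

(* The sequence is indexed from 1, so entry 0 is not used. If some entry vanishes, the summand
   1 / 0 is 0 here instead of infinity; for entries having a density this is a null event. *)
definition mean_reciprocal :: "nat \<Rightarrow> (nat \<Rightarrow> real) \<Rightarrow> real" where
  "mean_reciprocal n x = (1 / real n) * (\<Sum>i = 1..n. 1 / x i)"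

definition harmonic_mean :: "nat \<Rightarrow> (nat \<Rightarrow> real) \<Rightarrow> real" where
  "harmonic_mean n x = 1 / mean_reciprocal n x"

end

(* Write Z = 1/x. The tangent line of 1/y at m gives
   1/y = 1/m - (y - m)/m^2 + (y - m)^2/(m^2 y). Taking expectations of the sample mean of the Z_i
   with m = E Z bounds E(H_n) below by 1/E Z. Above, Z need not have finite variance (this fails for
   beta <= 1), so each Z_i is first truncated at K, which only decreases the sample mean; as
   y, m >= 1, the quadratic term is then at most Var/n. Let n and then K tend to infinity.
   Since beta > 0, f(t)/t is O(t^(beta - 1)) near 0, which makes E Z finite. *)
theory Submission
  imports Defs
begin

section \<open>Second moments of sums of independent centered variables\<close>

text \<open>Induction on \<open>I\<close>: a new summand is independent of the old sum, so the cross
  term has expectation zero. Integrability is carried along in the induction because splitting the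
  expectation of the expanded square requires it.\<close>

lemma (in prob_space) indep_centered_sum_square:
  fixes W :: "'i \<Rightarrow> 'a \<Rightarrow> real"
  assumes "finite I" "indep_vars (\<lambda>_. borel) W I"
    and "\<And>i. i \<in> I \<Longrightarrow> integrable M (W i)"
    and "\<And>i. i \<in> I \<Longrightarrow> integrable M (\<lambda>\<omega>. (W i \<omega>)\<^sup>2)"
    and "\<And>i. i \<in> I \<Longrightarrow> expectation (W i) = 0"
  shows "integrable M (\<lambda>\<omega>. (\<Sum>i\<in>I. W i \<omega>)\<^sup>2) \<and>
    expectation (\<lambda>\<omega>. (\<Sum>i\<in>I. W i \<omega>)\<^sup>2) = (\<Sum>i\<in>I. expectation (\<lambda>\<omega>. (W i \<omega>)\<^sup>2))"
  using assms
proof (induction I rule: finite_induct)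
  case (insert j I)
  define S where "S = (\<lambda>\<omega>. \<Sum>i\<in>I. W i \<omega>)"
  have IH: "integrable M (\<lambda>\<omega>. (S \<omega>)\<^sup>2)"
    "expectation (\<lambda>\<omega>. (S \<omega>)\<^sup>2) = (\<Sum>i\<in>I. expectation (\<lambda>\<omega>. (W i \<omega>)\<^sup>2))"
    using insert.IH[OF indep_vars_subset[OF insert.prems(1)]] insert.prems
    unfolding S_def by auto
  have indep: "indep_var borel (W j) borel S"
    unfolding S_def using insert by (intro indep_vars_sum) auto
  have intS: "integrable M S"
    unfolding S_def using insert.prems by auto
  have Wj: "integrable M (W j)" "expectation (W j) = 0" "integrable M (\<lambda>\<omega>. (W j \<omega>)\<^sup>2)"
    using insert.prems by auto
  \<comment> \<open>For independent factors, integrability of each already gives integrability of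
    the product.\<close>
  have int: "integrable M (\<lambda>\<omega>. W j \<omega> * S \<omega>)"
    using indep_var_integrable[OF indep Wj(1) intS] .
  have zero: "expectation (\<lambda>\<omega>. W j \<omega> * S \<omega>) = 0"
    using indep_var_lebesgue_integral[OF indep Wj(1) intS] Wj(2) by simp
  have eq: "(\<Sum>i\<in>insert j I. W i \<omega>)\<^sup>2 = (W j \<omega>)\<^sup>2 + (S \<omega>)\<^sup>2 + 2 * (W j \<omega> * S \<omega>)" for \<omega>
    using insert.hyps by (simp add: S_def power2_sum)
  show ?case
    unfolding eq using insert.hyps Wj(3) IH int zero by simp
qed simp

section \<open>Bounds for the expectation of a reciprocal\<close>

text \<open>The remainder is exact, so one identity serves both directions: it is nonnegative for
  \<open>y > 0\<close>, and at most \<open>(y - m)\<^sup>2\<close> when \<open>y\<close> and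
  \<open>m\<close> are at least 1.\<close>

lemma inverse_tangent_identity:
  fixes y m :: real
  assumes "y \<noteq> 0" "m \<noteq> 0"
  shows "1 / y = 1 / m - (y - m) / m\<^sup>2 + (y - m)\<^sup>2 / (m\<^sup>2 * y)"
  using assms by (simp add: divide_simps power2_eq_square) algebra

text \<open>Jensen's inequality for the convex function \<open>1 / y\<close>: the tangent line at
  the mean lies below it, and its linear term averages to zero. The lower bound 1 on
  \<open>X\<close> makes \<open>1 / X\<close> bounded, hence integrable.\<close>

lemma (in prob_space) expectation_inverse_ge:
  fixes X :: "'a \<Rightarrow> real"
  assumes "integrable M X" "AE \<omega> in M. X \<omega> \<ge> 1"
  shows "expectation (\<lambda>\<omega>. 1 / X \<omega>) \<ge> 1 / expectation X"
proof -
  let ?m = "expectation X"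
  have [measurable]: "X \<in> borel_measurable M"
    using assms(1) by auto
  have m: "?m \<ge> 1"
    using integral_mono_AE[OF _ assms(1), of "\<lambda>_. 1"] assms(2) by (simp add: prob_space)
  have int: "integrable M (\<lambda>\<omega>. 1 / X \<omega>)"
    by (rule integrable_const_bound[of _ 1]) (use assms(2) in auto)
  have "1 / ?m = expectation (\<lambda>\<omega>. 1 / ?m - (X \<omega> - ?m) / ?m\<^sup>2)"
    using assms(1) by (simp add: prob_space)
  also have "\<dots> \<le> expectation (\<lambda>\<omega>. 1 / X \<omega>)"
  proof (rule integral_mono_AE)
    show "AE \<omega> in M. 1 / ?m - (X \<omega> - ?m) / ?m\<^sup>2 \<le> 1 / X \<omega>"
      using assms(2)
    proof eventually_elim
      case (elim \<omega>)
      then show ?case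
        using m inverse_tangent_identity[of "X \<omega>" ?m] by simp
    qed
  qed (use assms(1) int in auto)
  finally show ?thesis .
qed

lemma (in prob_space) expectation_inverse_le:
  fixes X :: "'a \<Rightarrow> real"
  assumes "integrable M X" "integrable M (\<lambda>\<omega>. (X \<omega> - expectation X)\<^sup>2)"
    and "AE \<omega> in M. X \<omega> \<ge> 1"
  shows "expectation (\<lambda>\<omega>. 1 / X \<omega>) \<le> 1 / expectation X + variance X"
proof -
  let ?m = "expectation X"
  have [measurable]: "X \<in> borel_measurable M"
    using assms(1) by auto
  have m: "?m \<ge> 1"
    using integral_mono_AE[OF _ assms(1), of "\<lambda>_. 1"] assms(3) by (simp add: prob_space)
  have int: "integrable M (\<lambda>\<omega>. 1 / X \<omega>)"
    by (rule integrable_const_bound[of _ 1]) (use assms(3) in auto)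
  have "expectation (\<lambda>\<omega>. 1 / X \<omega>)
      \<le> expectation (\<lambda>\<omega>. (1 / ?m - (X \<omega> - ?m) / ?m\<^sup>2) + (X \<omega> - ?m)\<^sup>2)"
  proof (rule integral_mono_AE)
    show "AE \<omega> in M. 1 / X \<omega> \<le> (1 / ?m - (X \<omega> - ?m) / ?m\<^sup>2) + (X \<omega> - ?m)\<^sup>2"
      using assms(3)
    proof eventually_elim
      case (elim \<omega>)
      have "1 * 1 \<le> ?m\<^sup>2 * X \<omega>"
        using elim m by (intro mult_mono) auto
      then have "(X \<omega> - ?m)\<^sup>2 / (?m\<^sup>2 * X \<omega>) \<le> (X \<omega> - ?m)\<^sup>2"
        by (simp add: divide_le_eq mult_le_cancel_left1)
      then show ?case
        using elim m inverse_tangent_identity[of "X \<omega>" ?m] by simp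
    qed
  qed (use assms(1,2) int in auto)
  also have "\<dots> = 1 / ?m + variance X"
    using assms(1,2) by (simp add: prob_space)
  finally show ?thesis .
qed

text \<open>The preceding bound is applied to the sample mean, which keeps the expectation of
  \<open>Y 1\<close> while independence divides the variance by \<open>n\<close>. The bound
  \<open>K\<close> makes the first and second moments finite; it does not enter the
  estimate.\<close>

lemma (in prob_space) expectation_inverse_sample_mean_le:
  fixes Y :: "nat \<Rightarrow> 'a \<Rightarrow> real"
  assumes indep: "indep_vars (\<lambda>_. borel) Y {1..}"
    and distr: "\<And>i. i \<ge> 1 \<Longrightarrow> distr M borel (Y i) = distr M borel (Y 1)"
    and bounds: "\<And>i \<omega>. Y i \<omega> \<in> {1..K}"
    and n: "n \<ge> 1"
  shows "expectation (\<lambda>\<omega>. 1 / ((1 / real n) * (\<Sum>i = 1..n. Y i \<omega>)))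
    \<le> 1 / expectation (Y 1) + variance (Y 1) / n"
proof -
  define m where "m = expectation (Y 1)"
  define v where "v = variance (Y 1)"
  define A where "A = (\<lambda>\<omega>. (1 / real n) * (\<Sum>i = 1..n. Y i \<omega>))"
  define W where "W = (\<lambda>i \<omega>. Y i \<omega> - m)"
  have meas: "Y i \<in> borel_measurable M" if "i \<ge> 1" for i
    using indep that by (auto simp: indep_vars_def)
  have int: "integrable M (Y i)" if "i \<ge> 1" for i
    by (rule integrable_const_bound[of _ K])
      (use bounds meas[OF that] in \<open>auto simp: abs_le_iff intro!: AE_I2\<close>, (smt (verit))+)
  \<comment> \<open>Both sides are the integral of \<open>g\<close> against the same law, so
    measurability of \<open>g\<close> suffices.\<close>
  have transfer: "expectation (\<lambda>\<omega>. g (Y i \<omega>)) = expectation (\<lambda>\<omega>. g (Y 1 \<omega>))"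
    if "i \<ge> 1" "g \<in> borel_measurable borel" for i and g :: "real \<Rightarrow> real"
    using integral_distr[OF meas[OF that(1)] that(2)] integral_distr[OF meas that(2), of 1]
      distr[OF that(1)] by simp
  have mean: "expectation (Y i) = m" if "i \<ge> 1" for i
    using transfer[OF that, of "\<lambda>x. x"] by (simp add: m_def)
  have square: "integrable M (\<lambda>\<omega>. (W i \<omega>)\<^sup>2)" if "i \<ge> 1" for i
  proof (rule integrable_const_bound[of _ "(K + \<bar>m\<bar>)\<^sup>2"])
    have "\<bar>Y i \<omega> - m\<bar> \<le> K + \<bar>m\<bar>" for \<omega>
      using bounds[of i \<omega>] unfolding atLeastAtMost_iff by linarith
    then show "AE \<omega> in M. norm ((W i \<omega>)\<^sup>2) \<le> (K + \<bar>m\<bar>)\<^sup>2"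
      unfolding W_def by (intro AE_I2) (simp add: abs_le_square_iff[symmetric] order_trans[OF _ abs_ge_self])
  qed (use meas[OF that] in \<open>simp add: W_def\<close>)
  have indepW: "indep_vars (\<lambda>_. borel) W {1..n}"
    unfolding W_def
    by (rule indep_vars_compose2[OF indep_vars_subset[OF indep]]) auto
  have sumW: "integrable M (\<lambda>\<omega>. (\<Sum>i = 1..n. W i \<omega>)\<^sup>2)"
    "expectation (\<lambda>\<omega>. (\<Sum>i = 1..n. W i \<omega>)\<^sup>2) = (\<Sum>i = 1..n. expectation (\<lambda>\<omega>. (W i \<omega>)\<^sup>2))"
    using indep_centered_sum_square[OF _ indepW] int square mean
    by (auto simp: W_def prob_space)
  have var: "expectation (\<lambda>\<omega>. (W i \<omega>)\<^sup>2) = v" if "i \<ge> 1" for i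
    unfolding W_def using transfer[OF that, of "\<lambda>x. (x - m)\<^sup>2"] by (simp add: v_def m_def)
  have intA: "integrable M A"
    unfolding A_def by (intro integrable_mult_right Bochner_Integration.integrable_sum int) auto
  have meanA: "expectation A = m"
    unfolding A_def using int mean n by simp
  have AW: "A \<omega> - m = (\<Sum>i = 1..n. W i \<omega>) / n" for \<omega>
    unfolding A_def W_def using n by (simp add: sum_subtractf field_simps)
  have intA2: "integrable M (\<lambda>\<omega>. (A \<omega> - expectation A)\<^sup>2)"
    unfolding meanA AW power_divide using sumW(1) by simp
  have varA: "variance A = v / n"
    unfolding meanA AW power_divide using sumW(2) var n by (simp add: power2_eq_square)
  have "real n \<le> (\<Sum>i = 1..n. Y i \<omega>)" for \<omega>
    using sum_mono[of "{1..n}" "\<lambda>_. 1" "\<lambda>i. Y i \<omega>"] bounds by auto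
  then have "A \<omega> \<ge> 1" for \<omega>
    unfolding A_def using n by simp
  then have "expectation (\<lambda>\<omega>. 1 / A \<omega>) \<le> 1 / m + v / n"
    using expectation_inverse_le[OF intA intA2] varA unfolding meanA by simp
  then show ?thesis
    unfolding A_def m_def v_def .
qed

section \<open>Truncation and the limit for integrable variables\<close>

text \<open>Dominated convergence with \<open>Z\<close> itself as the dominating function. The
  cutoff \<open>Suc k\<close> is never below 1, and \<open>max 1\<close> acts only on a null set;
  together they put the truncation in \<open>{1..real (Suc k)}\<close> at every point.\<close>

lemma (in prob_space) expectation_truncation_tendsto:
  fixes Z :: "'a \<Rightarrow> real"
  assumes "integrable M Z" "AE \<omega> in M. Z \<omega> \<ge> 1"
  shows "(\<lambda>k. expectation (\<lambda>\<omega>. min (real (Suc k)) (max 1 (Z \<omega>)))) \<longlonglongrightarrow> expectation Z"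
proof (rule integral_dominated_convergence[where w = Z])
  have [measurable]: "Z \<in> borel_measurable M"
    using assms(1) by auto
  show "Z \<in> borel_measurable M" "integrable M Z"
    "(\<lambda>\<omega>. min (real (Suc k)) (max 1 (Z \<omega>))) \<in> borel_measurable M" for k
    using assms(1) by measurable
  show "AE \<omega> in M. norm (min (real (Suc k)) (max 1 (Z \<omega>))) \<le> Z \<omega>" for k
    using assms(2) by eventually_elim auto
  show "AE \<omega> in M. (\<lambda>k. min (real (Suc k)) (max 1 (Z \<omega>))) \<longlonglongrightarrow> Z \<omega>"
    using assms(2)
  proof eventually_elim
    case (elim \<omega>)
    have "\<forall>\<^sub>F k in sequentially. min (real (Suc k)) (max 1 (Z \<omega>)) = Z \<omega>"
      using eventually_ge_at_top[of "nat \<lceil>Z \<omega>\<rceil>"]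
    proof eventually_elim
      case (elim k)
      then have "Z \<omega> \<le> real (Suc k)"
        by linarith
      then show ?case
        using \<open>Z \<omega> \<ge> 1\<close> by simp
    qed
    then show ?case
      by (rule tendsto_eventually)
  qed
qed

text \<open>Jensen's inequality bounds every term with \<open>n \<ge> 1\<close> below by the limit.
  For the upper bound the variables are replaced by truncations, which have finite variance even if
  \<open>Z 1\<close> does not.\<close>

lemma (in prob_space) expectation_inverse_sample_mean_tendsto:
  fixes Z :: "nat \<Rightarrow> 'a \<Rightarrow> real"
  assumes indep: "indep_vars (\<lambda>_. borel) Z {1..}"
    and distr: "\<And>i. i \<ge> 1 \<Longrightarrow> distr M borel (Z i) = distr M borel (Z 1)"
    and ge1: "\<And>i. i \<ge> 1 \<Longrightarrow> AE \<omega> in M. Z i \<omega> \<ge> 1"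
    and int: "integrable M (Z 1)"
  shows "(\<lambda>n. expectation (\<lambda>\<omega>. 1 / ((1 / real n) * (\<Sum>i = 1..n. Z i \<omega>))))
    \<longlonglongrightarrow> 1 / expectation (Z 1)"
proof -
  define m where "m = expectation (Z 1)"
  let ?E = "\<lambda>n. expectation (\<lambda>\<omega>. 1 / ((1 / real n) * (\<Sum>i = 1..n. Z i \<omega>)))"
  have meas: "Z i \<in> borel_measurable M" if "i \<ge> 1" for i
    using indep that by (auto simp: indep_vars_def)
  have m: "m \<ge> 1"
    using integral_mono_AE[OF _ int, of "\<lambda>_. 1"] ge1[of 1] by (simp add: prob_space m_def)
  have intZ: "integrable M (Z i)" if "i \<ge> 1" for i
    using integrable_distr_eq[OF meas[OF that], of "\<lambda>x. x"]
      integrable_distr_eq[OF meas[of 1], of "\<lambda>x. x"] distr[OF that] int by simp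
  have mean: "expectation (Z i) = m" if "i \<ge> 1" for i
    using integral_distr[OF meas[OF that], of "\<lambda>x. x"]
      integral_distr[OF meas[of 1], of "\<lambda>x. x"] distr[OF that] by (simp add: m_def)
  have all_ge1: "AE \<omega> in M. \<forall>i\<in>{1..n}. Z i \<omega> \<ge> 1" for n
    by (rule AE_finite_allI) (use ge1 in auto)
  \<comment> \<open>The case \<open>n = 0\<close> has to be excluded: there division by zero gives
    \<open>?E 0 = 0\<close>, which is less than \<open>1 / m\<close>.\<close>
  have lower: "1 / m \<le> ?E n" if "n \<ge> 1" for n
  proof -
    have "AE \<omega> in M. (1 / real n) * (\<Sum>i = 1..n. Z i \<omega>) \<ge> 1"
      using all_ge1[of n]
    proof eventually_elim
      case (elim \<omega>)
      then have "real n \<le> (\<Sum>i = 1..n. Z i \<omega>)"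
        using sum_mono[of "{1..n}" "\<lambda>_. 1" "\<lambda>i. Z i \<omega>"] by auto
      then show ?case
        using that by simp
    qed
    moreover have "expectation (\<lambda>\<omega>. (1 / real n) * (\<Sum>i = 1..n. Z i \<omega>)) = m"
      using intZ mean that by simp
    moreover have "integrable M (\<lambda>\<omega>. (1 / real n) * (\<Sum>i = 1..n. Z i \<omega>))"
      by (intro integrable_mult_right Bochner_Integration.integrable_sum intZ) auto
    ultimately show ?thesis
      using expectation_inverse_ge[of "\<lambda>\<omega>. (1 / real n) * (\<Sum>i = 1..n. Z i \<omega>)"] by metis
  qed
  define Y where "Y = (\<lambda>k i \<omega>. min (real (Suc k)) (max 1 (Z i \<omega>)))"
  have upper: "?E n \<le> 1 / expectation (Y k 1) + variance (Y k 1) / n" if n: "n \<ge> 1" for n k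
  proof -
    have meas_trunc: "(\<lambda>x::real. min (real (Suc k)) (max 1 x)) \<in> borel_measurable borel"
      by measurable
    have measY: "Y k i \<in> borel_measurable M" if "i \<ge> 1" for i
      unfolding Y_def using meas[OF that] by measurable
    have boundsY: "Y k i \<omega> \<in> {1..real (Suc k)}" for i \<omega>
      by (auto simp: Y_def)
    have "?E n \<le> expectation (\<lambda>\<omega>. 1 / ((1 / real n) * (\<Sum>i = 1..n. Y k i \<omega>)))"
    proof (rule integral_mono_AE)
      have sumY: "real n \<le> (\<Sum>i = 1..n. Y k i \<omega>)" for \<omega>
        using sum_mono[of "{1..n}" "\<lambda>_. 1" "\<lambda>i. Y k i \<omega>"] boundsY by auto
      \<comment> \<open>Where all \<open>Z i\<close> are at least 1, \<open>max 1\<close> changes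
        nothing and the cutoff can only lower each summand.\<close>
      have le: "AE \<omega> in M. (\<Sum>i = 1..n. Y k i \<omega>) \<le> (\<Sum>i = 1..n. Z i \<omega>)"
        using all_ge1[of n]
        by eventually_elim (auto simp: Y_def intro!: sum_mono)
      have [measurable]: "(\<lambda>\<omega>. \<Sum>i = 1..n. Y k i \<omega>) \<in> borel_measurable M"
        "(\<lambda>\<omega>. \<Sum>i = 1..n. Z i \<omega>) \<in> borel_measurable M"
        using meas measY by auto
      show "integrable M (\<lambda>\<omega>. 1 / ((1 / real n) * (\<Sum>i = 1..n. Z i \<omega>)))"
      proof (rule integrable_const_bound[of _ 1])
        show "AE \<omega> in M. norm (1 / ((1 / real n) * (\<Sum>i = 1..n. Z i \<omega>))) \<le> 1"
          using le
        proof eventually_elim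
          case (elim \<omega>)
          then show ?case
            using n sumY[of \<omega>] by (simp add: divide_le_eq)
        qed
      qed measurable
      show "integrable M (\<lambda>\<omega>. 1 / ((1 / real n) * (\<Sum>i = 1..n. Y k i \<omega>)))"
      proof (rule integrable_const_bound[of _ 1])
        show "AE \<omega> in M. norm (1 / ((1 / real n) * (\<Sum>i = 1..n. Y k i \<omega>))) \<le> 1"
          using n sumY by (intro AE_I2) (auto simp: divide_le_eq intro: order_trans[OF _ abs_ge_self])
      qed measurable
      show "AE \<omega> in M. 1 / ((1 / real n) * (\<Sum>i = 1..n. Z i \<omega>))
          \<le> 1 / ((1 / real n) * (\<Sum>i = 1..n. Y k i \<omega>))"
        using le
      proof eventually_elim
        case (elim \<omega>)
        have "0 < (\<Sum>i = 1..n. Y k i \<omega>)"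
          using sumY[of \<omega>] n by linarith
        then show ?case
          using n elim by (intro divide_left_mono mult_left_mono mult_pos_pos) auto
      qed
    qed
    also have "\<dots> \<le> 1 / expectation (Y k 1) + variance (Y k 1) / n"
    proof (rule expectation_inverse_sample_mean_le[OF _ _ boundsY n])
      show "indep_vars (\<lambda>_. borel) (Y k) {1..}"
        unfolding Y_def by (rule indep_vars_compose2[OF indep meas_trunc])
      show "distr M borel (Y k i) = distr M borel (Y k 1)" if "i \<ge> 1" for i
        using distr_distr[OF meas_trunc meas[OF that]] distr_distr[OF meas_trunc meas[of 1]]
          distr[OF that] by (simp add: Y_def comp_def)
    qed
    finally show ?thesis .
  qed
  have trunc: "(\<lambda>k. 1 / expectation (Y k 1)) \<longlonglongrightarrow> 1 / m"
    unfolding Y_def m_def using m[unfolded m_def]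
    by (intro tendsto_divide tendsto_const expectation_truncation_tendsto int ge1) auto
  show ?thesis
    unfolding m_def[symmetric]
  proof (rule order_tendstoI)
    fix a assume a: "a < 1 / m"
    show "\<forall>\<^sub>F n in sequentially. a < ?E n"
      using eventually_ge_at_top[of "1::nat"]
      by eventually_elim (rule less_le_trans[OF a lower])
  next
    fix a assume "a > 1 / m"
    \<comment> \<open>The level \<open>k\<close> is fixed before \<open>n\<close> grows: the
      variance of \<open>Y k 1\<close> need not stay bounded in \<open>k\<close>, but for fixed
      \<open>k\<close> it is divided by \<open>n\<close>.\<close>
    then obtain k where k: "1 / expectation (Y k 1) < a"
      using order_tendstoD(2)[OF trunc] by (auto simp: eventually_sequentially)
    have "(\<lambda>n. 1 / expectation (Y k 1) + variance (Y k 1) / real n)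
        \<longlonglongrightarrow> 1 / expectation (Y k 1) + 0"
      by (intro tendsto_add tendsto_const lim_const_over_n)
    then have "\<forall>\<^sub>F n in sequentially. 1 / expectation (Y k 1) + variance (Y k 1) / real n < a"
      by (rule order_tendstoD(2)) (use k in simp)
    then show "\<forall>\<^sub>F n in sequentially. ?E n < a"
      using eventually_ge_at_top[of "1::nat"]
      by eventually_elim (rule le_less_trans[OF upper])
  qed
qed

section \<open>Finiteness of the expected reciprocal\<close>

text \<open>The integral of \<open>f t / t\<close> is split at a small \<open>e\<close>. Below
  \<open>e\<close> the asymptotics of \<open>f\<close> give the integrable bound
  \<open>2 * c * t powr (\<beta> - 1)\<close>; above \<open>e\<close> the factor
  \<open>1 / t\<close> is at most \<open>1 / e\<close> and \<open>f\<close> has total mass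
  1.\<close>

lemma integrable_reciprocal_of_density:
  fixes X :: "'a \<Rightarrow> real" and f :: "real \<Rightarrow> real"
  assumes "prob_space M"
    and X: "distributed M lborel X (\<lambda>t. ennreal (f t))"
    and nonneg: "\<And>t. f t \<ge> 0"
    and X_nonneg: "\<And>\<omega>. \<omega> \<in> space M \<Longrightarrow> X \<omega> \<ge> 0"
    and c: "c > 0" and \<beta>: "\<beta> > 0"
    and lim: "((\<lambda>t. f t / (c * t powr \<beta>)) \<longlongrightarrow> 1) (at_right 0)"
  shows "integrable M (\<lambda>\<omega>. 1 / X \<omega>)"
proof -
  interpret prob_space M by fact
  have [measurable]: "X \<in> borel_measurable M" "f \<in> borel_measurable borel"
    using distributed_measurable[OF X] distributed_real_measurable[OF _ X] nonneg by auto
  \<comment> \<open>Any constant above the limit 1 would do in place of 2.\<close>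
  have "\<forall>\<^sub>F t in at_right 0. f t / (c * t powr \<beta>) < 2"
    by (rule order_tendstoD(2)[OF lim]) simp
  then obtain d where d: "d > 0" "\<And>t. 0 < t \<Longrightarrow> t < d \<Longrightarrow> f t / (c * t powr \<beta>) < 2"
    by (auto simp: eventually_at_right_field)
  \<comment> \<open>Halving \<open>d\<close> puts the closed interval up to \<open>e\<close> inside
    the open range where the estimate holds.\<close>
  define e where "e = d / 2"
  have e: "e > 0" "e < d"
    using d by (auto simp: e_def)
  have small: "f t / t \<le> 2 * c * t powr (\<beta> - 1)" if "0 < t" "t \<le> e" for t
  proof -
    have "f t \<le> 2 * c * t powr \<beta>"
      using d(2)[of t] that e c by (simp add: divide_less_eq)
    then have "f t / t \<le> 2 * c * t powr \<beta> / t"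
      using that by (intro divide_right_mono) auto
    also have "\<dots> = 2 * c * t powr (\<beta> - 1)"
      using that by (simp add: powr_diff)
    finally show ?thesis .
  qed
  have "(\<integral>\<^sup>+\<omega>. ennreal (1 / X \<omega>) \<partial>M) \<le> (\<integral>\<^sup>+t. ennreal (f t) * ennreal (1 / t) \<partial>lborel)"
    by (subst distributed_nn_integral[OF X, symmetric]) auto
  also have "\<dots> \<le> (\<integral>\<^sup>+t. ennreal (2 * c) * ennreal (indicator {0..e} t * t powr (\<beta> - 1))
      + ennreal (1 / e) * ennreal (f t) \<partial>lborel)"
  proof (rule nn_integral_mono)
    fix t :: real
    consider "t \<le> 0" | "0 < t" "t \<le> e" | "t > e"
      by linarith
    then show "ennreal (f t) * ennreal (1 / t)
      \<le> ennreal (2 * c) * ennreal (indicator {0..e} t * t powr (\<beta> - 1)) + ennreal (1 / e) * ennreal (f t)"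
    proof cases
      \<comment> \<open>Here \<open>1 / t\<close> is at most 0, including the value
        \<open>1 / 0 = 0\<close>, so \<open>ennreal\<close> sends it to 0.\<close>
      case 1
      then show ?thesis
        by (simp add: ennreal_neg divide_nonneg_nonpos)
    next
      case 2
      then have "ennreal (f t) * ennreal (1 / t) \<le> ennreal (2 * c * t powr (\<beta> - 1))"
        using small[OF 2] nonneg[of t] by (simp add: ennreal_mult[symmetric] ennreal_leI)
      also have "\<dots> = ennreal (2 * c) * ennreal (indicator {0..e} t * t powr (\<beta> - 1))"
        using 2 c by (simp add: ennreal_mult)
      finally show ?thesis
        by (rule order_trans) simp
    next
      case 3
      then have "f t * (1 / t) \<le> 1 / e * f t"
        using e nonneg[of t] by (simp add: frac_le)
      then have "ennreal (f t) * ennreal (1 / t) \<le> ennreal (1 / e) * ennreal (f t)"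
        using 3 e nonneg[of t] by (simp add: ennreal_mult[symmetric] ennreal_leI)
      then show ?thesis
        by (rule order_trans) simp
    qed
  qed
  also have "\<dots> = ennreal (2 * c) * (\<integral>\<^sup>+t. ennreal (indicator {0..e} t * t powr (\<beta> - 1)) \<partial>lborel)
      + ennreal (1 / e) * (\<integral>\<^sup>+t. ennreal (f t) \<partial>lborel)"
    by (subst nn_integral_add) (auto simp: nn_integral_cmult)
  \<comment> \<open>The power is integrable down to 0 because \<open>\<beta> > 0\<close> means that
    the exponent exceeds -1.\<close>
  also have "(\<integral>\<^sup>+t. ennreal (indicator {0..e} t * t powr (\<beta> - 1)) \<partial>lborel)
      = ennreal (e powr (\<beta> - 1 + 1) / (\<beta> - 1 + 1))"
    using e \<beta> by (intro nn_integral_has_integral_lebesgue has_integral_powr_from_0) auto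
  also have "(\<integral>\<^sup>+t. ennreal (f t) \<partial>lborel) = 1"
    using distributed_nn_integral[OF X, of "\<lambda>_. 1"] emeasure_space_1 by simp
  finally have "(\<integral>\<^sup>+\<omega>. ennreal (1 / X \<omega>) \<partial>M) < \<infinity>"
    by (rule order.strict_trans1) (simp add: ennreal_mult_less_top)
  \<comment> \<open>As \<open>X\<close> is nonnegative, so is \<open>1 / X\<close>, and
    \<open>ennreal\<close> has cut nothing off.\<close>
  then show ?thesis
    using X_nonneg by (intro integrableI_nonneg) auto
qed

section \<open>The limit for the harmonic mean, applied to the reciprocals of the
  \<open>x i\<close>\<close>

theorem theoremF:
  fixes M :: "'a measure"
    and x :: "nat \<Rightarrow> 'a \<Rightarrow> real"
    and f :: "real \<Rightarrow> real"
    and c \<beta> :: real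
  assumes "prob_space M"
    and "prob_space.indep_vars M (\<lambda>_. borel) x {1..}"
    and "\<And>i \<omega>. i \<ge> 1 \<Longrightarrow> \<omega> \<in> space M \<Longrightarrow> x i \<omega> \<in> {0..1}"
    and "\<And>t. f t \<ge> 0"
    and "\<And>i. i \<ge> 1 \<Longrightarrow> distributed M lborel (x i) (\<lambda>t. ennreal (f t))"
    and "c > 0" and "\<beta> > 0"
    and "((\<lambda>t. f t / (c * t powr \<beta>)) \<longlongrightarrow> 1) (at_right 0)"
  defines "\<E> \<equiv> prob_space.expectation M (\<lambda>\<omega>. 1 / x 1 \<omega>)"
  shows "(\<lambda>n. prob_space.expectation M (\<lambda>\<omega>. \<E> * harmonic_mean n (\<lambda>i. x i \<omega>))) \<longlonglongrightarrow> 1"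
proof -
  interpret prob_space M by fact
  have meas: "x i \<in> borel_measurable M" if "i \<ge> 1" for i
    using distributed_measurable[OF assms(5)[OF that]] by simp
  have int: "integrable M (\<lambda>\<omega>. 1 / x 1 \<omega>)"
    using integrable_reciprocal_of_density[OF assms(1) assms(5)[of 1] assms(4) _ assms(6-8)] assms(3)
    by simp
  have recip_meas: "(\<lambda>t::real. 1 / t) \<in> borel_measurable borel"
    by measurable
  \<comment> \<open>A law with a density gives no mass to the point 0, the only point of
    \<open>{0..1}\<close> where the bound fails, because there \<open>1 / 0 = 0\<close>.\<close>
  have ge1: "AE \<omega> in M. 1 / x i \<omega> \<ge> 1" if "i \<ge> 1" for i
  proof -
    have "AE t in lborel. t \<noteq> (0::real)"
      by (rule AE_lborel_singleton)
    then have "AE t in distr M lborel (x i). t \<noteq> 0"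
      unfolding distributed_distr_eq_density[OF assms(5)[OF that]]
      by (subst AE_density) (use distributed_borel_measurable[OF assms(5)[OF that]] in auto)
    then have "AE \<omega> in M. x i \<omega> \<noteq> 0"
      by (subst (asm) AE_distr_iff) (use meas[OF that] in auto)
    then show ?thesis
      using AE_space
    proof eventually_elim
      case (elim \<omega>)
      then show ?case
        using assms(3)[OF that, of \<omega>] by (simp add: le_divide_eq)
    qed
  qed
  have distr: "distr M borel (\<lambda>\<omega>. 1 / x i \<omega>) = distr M borel (\<lambda>\<omega>. 1 / x 1 \<omega>)" if "i \<ge> 1" for i
  proof -
    have "distr M lborel (x i) = distr M lborel (x 1)"
      using distributed_distr_eq_density[OF assms(5)[OF that]]
        distributed_distr_eq_density[OF assms(5)[of 1]] by simp
    \<comment> \<open>\<open>distr\<close> depends on its target only through the space and the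
      measurable sets, which \<open>lborel\<close> and \<open>borel\<close> share.\<close>
    then have "distr M borel (x i) = distr M borel (x 1)"
      by (metis distr_cong sets_lborel)
    then show ?thesis
      using distr_distr[OF recip_meas meas[OF that]] distr_distr[OF recip_meas meas[of 1]]
      by (simp add: comp_def)
  qed
  \<comment> \<open>In particular \<open>\<E>\<close> is nonzero, so that it cancels in
    \<open>\<E> * (1 / \<E>)\<close>.\<close>
  have "\<E> \<ge> 1"
    unfolding \<E>_def
    using integral_mono_AE[OF _ int, of "\<lambda>_. 1"] ge1[of 1] by (simp add: prob_space)
  moreover have "(\<lambda>n. expectation (\<lambda>\<omega>. harmonic_mean n (\<lambda>i. x i \<omega>))) \<longlonglongrightarrow> 1 / \<E>"
    unfolding harmonic_mean_def mean_reciprocal_def \<E>_def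
    by (rule expectation_inverse_sample_mean_tendsto[OF
          indep_vars_compose2[OF assms(2) recip_meas] distr ge1 int])
  then have "(\<lambda>n. \<E> * expectation (\<lambda>\<omega>. harmonic_mean n (\<lambda>i. x i \<omega>))) \<longlonglongrightarrow> \<E> * (1 / \<E>)"
    by (rule tendsto_mult_left)
  ultimately show ?thesis
    by simp
qed

end
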